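(* Let $S$ be a finite set of integers, let $\omega \in S^{\mathbb{N}}$ be a uniformly recurrent word with bounded additive complexity, and suppose that $\mathrm{slope}(\omega) \in \mathbb{Q}$. Then $\omega$ admits a factorization of the form $\omega = AB_1B_2B_3\cdots$, where $A$ is a finite (possibly empty) word and $\{B_i\}_{i\in\mathbb{N}}$ is a sequence of nonempty factors of $\omega$ such that: (i) $\mathrm{slope}(B_i) = \mathrm{slope}(\omega)$ for all $i \in \mathbb{N}$; (ii) the sequence of lengths $\{|B_i|\}_{i\in\mathbb{N}}$ is bounded.
   Context: $\mathbb{N}$ denotes the positive integers. Alphabets are finite sets of integers. An infinite word over $S$ is a sequence $\omega = x_1x_2x_3\cdots$ with $x_i \in S$; $S^{\mathbb{N}}$ is the set of these. For $m \le n$, $\omega[m,n] = x_m x_{m+1}\cdots x_n$; the nonempty factors of $\omega$ are the finite words of this form, and $\mathcal{F}^n(\omega)$ is the set of factors of length $n$. A finite word $B$ is a factor of a finite word $C$ if $C = B'BB''$ for some finite words $B',B''$. $\omega$ is uniformly recurrent if for every $n\in\mathbb{N}$ there is a positive integer $K(n)$ such that every $B' \in \mathcal{F}^n(\omega)$ is a factor of every $B \in \mathcal{F}^{K(n)}(\omega)$. $|B|$ is the length of a finite word $B$, and if $B = y_1\cdots y_n$ then $\sum B = y_1+\cdots+y_n$. $\omega$ has bounded additive complexity if there is $M\in\mathbb{N}$ such that $|\{\sum B : B \in \mathcal{F}^n(\omega)\}| \le M$ for every $n\in\mathbb{N}$. For a nonempty finite word $B$, $\mathrm{slope}(B) = \frac{1}{|B|}\sum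 B$; for an infinite word, $\mathrm{slope}(\omega) = \lim_{n\to\infty} \mathrm{slope}(\omega[1,n])$, if this limit exists (it exists whenever $\omega$ has bounded additive complexity). *)

theory Defs
  imports "HOL-Analysis.Analysis" "HOL-Library.Stream" "HOL-Library.Sublist"
begin

text \<open>
  An infinite word over \<open>S\<close> is an element of \<^term>\<open>streams S\<close>, a finite word is a list. Streams are
  indexed from 0, so the word written $\omega[m,n]$ with 1-based positions $1 \le m \le n$ is
  \<open>stake (n - m + 1) (sdrop (m - 1) \<omega>)\<close>. The infinite concatenation $B_1 B_2 \cdots$ of
  \<^emph>\<open>nonempty\<close> finite words is \<^const>\<open>flat\<close>; on empty blocks \<^const>\<open>flat\<close> is unspecified.
\<close>

definition factors_of_length :: "nat \<Rightarrow> 'a stream \<Rightarrow> 'a list set" where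
  "factors_of_length n \<omega> = {stake n (sdrop m \<omega>) | m. True}"

definition nonempty_factors :: "'a stream \<Rightarrow> 'a list set" where
  "nonempty_factors \<omega> = (\<Union>n\<in>{1..}. factors_of_length n \<omega>)"

definition uniformly_recurrent :: "'a stream \<Rightarrow> bool" where
  "uniformly_recurrent \<omega> \<longleftrightarrow>
     (\<forall>n\<ge>1. \<exists>K\<ge>1. \<forall>B'\<in>factors_of_length n \<omega>. \<forall>B\<in>factors_of_length K \<omega>. sublist B' B)"

text \<open>Finiteness is required explicitly because \<^const>\<open>card\<close> is 0 on infinite sets.\<close>

definition bounded_additive_complexity :: "int stream \<Rightarrow> bool" where
  "bounded_additive_complexity \<omega> \<longleftrightarrow>
     (\<exists>M\<ge>1. \<forall>n\<ge>1. finite (sum_list ` factors_of_length n \<omega>) \<and>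
                   card (sum_list ` factors_of_length n \<omega>) \<le> M)"

definition word_slope :: "int list \<Rightarrow> real" where
  "word_slope B = real_of_int (sum_list B) / real (length B)"

text \<open>
  Meaningful only if the limit exists, which is the case for words of bounded additive complexity.
\<close>

definition slope :: "int stream \<Rightarrow> real" where
  "slope \<omega> = lim (\<lambda>n. word_slope (stake n \<omega>))"

end

theory Submission
  imports Defs
begin

text \<open>
  Bounded additive complexity together with bounded letters forces the sums of any two factors of
  equal length to differ by a bounded amount, so the prefix sums \<open>P n\<close> satisfy
  \<open>\<bar>P n - n * \<alpha>\<bar> \<le> C\<close> with \<open>\<alpha> = p / q\<close> the slope. Hence the integers
  \<open>f n = q * P n - p * n\<close> take only finitely many values. Choose a prefix long enough for \<open>f\<close> to
  attain both its maximum and its minimum on it. If this prefix recurs at position \<open>m\<close>, then \<open>f\<close>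
  restricted to that occurrence is shifted by \<open>f m\<close>, and staying between the minimum and the maximum
  forces \<open>f m = 0\<close>. By uniform recurrence such positions have bounded gaps, and cutting the word
  there gives the factorization, with empty \<open>A\<close>.
\<close>

text \<open>Cut the integers into bins of width \<open>D\<close>, counted from \<open>a i\<close>.
  The bin number \<open>b\<close> moves by at most one per step, so a rise of more than
  \<open>D * int M\<close> makes it visit all of 0, ..., \<open>M\<close>. These
  \<open>M + 1\<close> bins need \<open>M + 1\<close> distinct values of \<open>a\<close>.\<close>

lemma increment_le_card_range:
  fixes a :: "nat \<Rightarrow> int"
  assumes step: "\<And>m. \<bar>a (Suc m) - a m\<bar> \<le> D" and "D \<ge> 1"
    and fin: "finite (range a)" and card: "card (range a) \<le> M" and "i \<le> j"
  shows "a j - a i \<le> D * int M"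
proof (rule ccontr)
  assume "\<not> a j - a i \<le> D * int M"
  then have big: "D * int M \<le> a j - a i" by simp
  define b where "b m = (a m - a i) div D" for m
  have b_step: "\<bar>b (Suc m) - b m\<bar> \<le> 1" for m
  proof -
    have "(x + y) div D \<le> x div D + 1" if "y \<le> D" for x y
      using zdiv_mono1[of "x + y" "x + D" D] that \<open>D \<ge> 1\<close> by simp
    from this[of "a (Suc m) - a m" "a m - a i"] this[of "a m - a (Suc m)" "a (Suc m) - a i"] step[of m]
    show ?thesis by (simp add: b_def abs_le_iff)
  qed
  have "int M \<le> b j"
    using zdiv_mono1[OF big, of D] \<open>D \<ge> 1\<close> by (simp add: b_def)
  have "{0..int M} \<subseteq> (\<lambda>v. (v - a i) div D) ` range a"
  proof
    fix k assume "k \<in> {0..int M}"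
    then have "\<exists>m\<ge>i. m \<le> j \<and> b m = k"
      using nat_intermed_int_val[of i j b k] b_step \<open>i \<le> j\<close> \<open>int M \<le> b j\<close> by (auto simp: b_def)
    then show "k \<in> (\<lambda>v. (v - a i) div D) ` range a" by (auto simp: b_def)
  qed
  then have "card {0..int M} \<le> card (range a)"
    using fin by (meson surj_card_le)
  with card show False by simp
qed

lemma oscillation_le_card_range:
  fixes a :: "nat \<Rightarrow> int"
  assumes step: "\<And>m. \<bar>a (Suc m) - a m\<bar> \<le> D" and "D \<ge> 1"
    and fin: "finite (range a)" and card: "card (range a) \<le> M"
  shows "\<bar>a j - a i\<bar> \<le> D * int M"
proof -
  have neg: "range (\<lambda>m. - a m) = uminus ` range a" by auto
  have "\<bar>a j - a i\<bar> \<le> D * int M" if "i \<le> j" for i j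
    using increment_le_card_range[of a D M i j] increment_le_card_range[of "\<lambda>m. - a m" D M i j]
      assms that by (simp add: neg card_image abs_le_iff abs_minus_commute)
  from this[of i j] this[of j i] show ?thesis by (cases "i \<le> j") (auto simp: abs_minus_commute)
qed

text \<open>Expanding \<open>g (k * n)\<close> as \<open>k\<close> copies of \<open>g n\<close> and
  as \<open>n\<close> copies of \<open>g k\<close> compares \<open>g n / n\<close> with
  \<open>g k / k\<close>. The comparison gives the Cauchy property, and letting \<open>k\<close>
  tend to infinity with \<open>n\<close> fixed gives the deviation bound with the same constant
  \<open>C\<close>.\<close>

lemma almost_additive_limit:
  fixes g :: "nat \<Rightarrow> real"
  assumes additive: "\<And>m n. \<bar>g (m + n) - g m - g n\<bar> \<le> C"
  shows "convergent (\<lambda>n. g n / real n)"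
    and "\<bar>g n - real n * lim (\<lambda>n. g n / real n)\<bar> \<le> C"
proof -
  have C: "C \<ge> 0" using additive[of 0 0] by linarith
  have mult: "\<bar>g (k * n) - real k * g n\<bar> \<le> real (Suc k) * C" for k n
  proof (induction k)
    case 0
    then show ?case using additive[of 0 0] by simp
  next
    case (Suc k)
    then show ?case using additive[of n "k * n"] by (simp add: algebra_simps)
  qed
  have cross: "\<bar>real n * g k - real k * g n\<bar> \<le> (real n + real k + 2) * C" for n k
    using mult[of k n] mult[of n k] by (simp add: algebra_simps)
  show conv: "convergent (\<lambda>n. g n / real n)"
  proof (rule Cauchy_convergent, rule metric_CauchyI)
    fix e :: real assume "e > 0"
    \<comment> \<open>For \<open>n\<close>, \<open>k\<close> at least 1, \<open>n + k + 2\<close> is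
      at most \<open>2 * (n + k)\<close>. Thus \<open>cross\<close> divided by \<open>n * k\<close>
      leaves at most \<open>2 * C / n + 2 * C / k\<close>, which is below \<open>e\<close> beyond
      \<open>4 * C / e\<close>.\<close>
    obtain N' where "real N' > 4 * C / e" using reals_Archimedean2 by blast
    then have N: "real (Suc N') > 4 * C / e" "Suc N' \<ge> 1" by auto
    define N where "N = Suc N'"
    note N = N[folded N_def]
    have "dist (g n / real n) (g k / real k) < e" if "n \<ge> N" "k \<ge> N" for n k
    proof -
      have pos: "real n \<ge> N" "real k \<ge> N" "real N \<ge> 1" using that N by auto
      have "C * 4 < e * N" using N \<open>e > 0\<close> by (simp add: field_simps)
      moreover have "e * N \<le> e * n" "e * N \<le> e * k" using pos \<open>e > 0\<close> by auto
      ultimately have "(C * 4) * k \<le> (e * n) * k" "(C * 4) * n < (e * k) * n"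
        using pos by (auto intro!: mult_right_mono mult_strict_right_mono)
      moreover have "C * 1 \<le> C * n" "C * 1 \<le> C * k"
        using mult_left_mono[of 1 "real n" C] mult_left_mono[of 1 "real k" C] pos C by linarith+
      ultimately have "(real n + real k + 2) * C < e * (real n * real k)"
        by (simp add: algebra_simps)
      with cross[of n k] have "\<bar>real n * g k - real k * g n\<bar> < e * (real n * real k)" by linarith
      moreover have "dist (g n / real n) (g k / real k) = \<bar>real n * g k - real k * g n\<bar> / (real n * real k)"
        using pos by (simp add: dist_real_def diff_frac_eq abs_divide abs_mult abs_minus_commute mult.commute)
      ultimately show ?thesis using pos by (simp add: divide_less_eq)
    qed
    then show "\<exists>N. \<forall>m\<ge>N. \<forall>n\<ge>N. dist (g m / real m) (g n / real n) < e" by blast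
  qed
  let ?\<alpha> = "lim (\<lambda>n. g n / real n)"
  have "(\<lambda>k. \<bar>g n - real n * (g k / real k)\<bar>) \<longlonglongrightarrow> \<bar>g n - real n * ?\<alpha>\<bar>"
    using conv by (intro tendsto_intros) (simp add: convergent_LIMSEQ_iff)
  moreover have "(\<lambda>k. C + (real n + 2) * C / real k) \<longlonglongrightarrow> C + 0"
    by (intro tendsto_intros lim_const_over_n)
  moreover
  have "\<bar>g n - real n * (g k / real k)\<bar> \<le> C + (real n + 2) * C / real k" if "k \<ge> 1" for k
  proof -
    have "\<bar>g n - real n * (g k / real k)\<bar> = \<bar>real n * g k - real k * g n\<bar> / real k"
      using that by (simp add: field_simps abs_divide[symmetric] abs_minus_commute)
    also have "\<dots> \<le> ((real n + real k + 2) * C) / real k"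
      using cross by (intro divide_right_mono) auto
    also have "\<dots> = C + (real n + 2) * C / real k" using that by (simp add: field_simps)
    finally show ?thesis .
  qed
  then have "\<exists>N. \<forall>k\<ge>N. \<bar>g n - real n * (g k / real k)\<bar> \<le> C + (real n + 2) * C / real k"
    by blast
  ultimately have "\<bar>g n - real n * ?\<alpha>\<bar> \<le> C + 0"
    by (rule LIMSEQ_le)
  then show "\<bar>g n - real n * ?\<alpha>\<bar> \<le> C" by simp
qed

lemma sum_list_stake_sdrop:
  fixes \<omega> :: "int stream"
  shows "sum_list (stake n (sdrop m \<omega>)) = sum_list (stake (m + n) \<omega>) - sum_list (stake m \<omega>)"
  by (simp flip: stake_add)

text \<open>The two streams are compared letter by letter. A position lies in the first block or,
  since that block is nonempty, at a smaller index of the remainder from \<open>t (Suc k)\<close>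
  on; hence the induction keeps \<open>k\<close> arbitrary.\<close>

lemma sdrop_eq_flat_blocks:
  assumes "strict_mono t"
  shows "sdrop (t k) \<omega> = flat (smap (\<lambda>i. stake (t (Suc i) - t i) (sdrop (t i) \<omega>)) (fromN k))"
    (is "_ = flat (smap ?B _)")
proof -
  have less: "t k < t (Suc k)" for k using assms by (simp add: strict_mono_Suc_iff)
  have unfold: "flat (smap ?B (fromN k)) = ?B k @- flat (smap ?B (fromN (Suc k)))" for k
    using less[of k] by (subst flat_unfold) (auto simp: siterate.code[of _ k])
  have split: "sdrop (t k) \<omega> = ?B k @- sdrop (t (Suc k)) \<omega>" for k
    using less[of k] stake_sdrop[of "t (Suc k) - t k" "sdrop (t k) \<omega>"] by simp
  have "sdrop (t k) \<omega> !! n = flat (smap ?B (fromN k)) !! n" for n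
  proof (induction n arbitrary: k rule: less_induct)
    case (less n)
    then show ?case
      using \<open>t k < t (Suc k)\<close> by (subst split, subst unfold) (auto simp: shift_snth)
  qed
  then have "snth (sdrop (t k) \<omega>) = snth (flat (smap ?B (fromN k)))" by (rule ext)
  then show ?thesis by (metis stream_smap_nats)
qed

text \<open>Sliding a window of length \<open>n\<close> by one letter drops one letter and gains
  another, so its sum changes by at most \<open>2 * D\<close>. Few values and small steps then bound
  the oscillation uniformly in \<open>n\<close>.\<close>

lemma bounded_additive_complexity_sums:
  fixes \<omega> :: "int stream"
  assumes "finite S" and "\<omega> \<in> streams S" and "bounded_additive_complexity \<omega>"
  obtains C where "\<And>n i j. \<bar>sum_list (stake n (sdrop j \<omega>)) - sum_list (stake n (sdrop i \<omega>))\<bar> \<le> C"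
proof -
  obtain M where M: "\<And>n. n \<ge> 1 \<Longrightarrow> finite (sum_list ` factors_of_length n \<omega>)"
      "\<And>n. n \<ge> 1 \<Longrightarrow> card (sum_list ` factors_of_length n \<omega>) \<le> M"
    using assms(3) by (auto simp: bounded_additive_complexity_def)
  obtain D where D: "\<And>x. x \<in> S \<Longrightarrow> \<bar>x\<bar> \<le> D"
    using finite_imageI[OF assms(1), of abs] by (metis Max_ge imageI)
  have letter: "\<bar>\<omega> !! m\<bar> \<le> D" for m using assms(2) D by (simp add: snth_in)
  \<comment> \<open>The extra 1 keeps \<open>E\<close> positive even when
    \<open>D = 0\<close>.\<close>
  define E where "E = 2 * D + 1"
  have "E \<ge> 1" using letter[of 0] by (simp add: E_def)
  have "\<bar>sum_list (stake n (sdrop j \<omega>)) - sum_list (stake n (sdrop i \<omega>))\<bar> \<le> E * int M" for n i j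
  proof (cases "n = 0")
    case False
    let ?a = "\<lambda>m. sum_list (stake n (sdrop m \<omega>))"
    have "\<bar>?a (Suc m) - ?a m\<bar> \<le> E" for m
      using letter[of m] letter[of "m + n"]
      unfolding sum_list_stake_sdrop add_Suc stake_Suc sum_list_append E_def by simp
    moreover have "range ?a = sum_list ` factors_of_length n \<omega>"
      by (auto simp: factors_of_length_def)
    ultimately show ?thesis
      using M[of n] False \<open>E \<ge> 1\<close> by (intro oscillation_le_card_range[of ?a]) auto
  qed (use \<open>E \<ge> 1\<close> in auto)
  then show thesis by (rule that)
qed

text \<open>The window of length \<open>K\<close> starting at \<open>n\<close> contains a copy of
  the prefix, and the offset of that copy in the window gives \<open>m\<close>.\<close>

lemma uniformly_recurrent_prefix:
  assumes "uniformly_recurrent \<omega>" and "N \<ge> 1"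
  obtains K where "\<And>n. \<exists>m\<ge>n. m \<le> n + K \<and> stake N (sdrop m \<omega>) = stake N \<omega>"
proof -
  obtain K where K: "\<forall>B'\<in>factors_of_length N \<omega>. \<forall>B\<in>factors_of_length K \<omega>. sublist B' B"
    using assms unfolding uniformly_recurrent_def by blast
  have "\<exists>m\<ge>n. m \<le> n + K \<and> stake N (sdrop m \<omega>) = stake N \<omega>" for n
  proof -
    have "stake N \<omega> \<in> factors_of_length N \<omega>" "stake K (sdrop n \<omega>) \<in> factors_of_length K \<omega>"
      by (auto simp: factors_of_length_def) (metis sdrop.simps(1))
    then obtain xs ys where eq: "stake K (sdrop n \<omega>) = xs @ stake N \<omega> @ ys"
      using K by (meson sublist_def)
    have len: "K = length xs + N + length ys" using arg_cong[OF eq, of length] by simp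
    have "take N (drop (length xs) (stake K (sdrop n \<omega>))) = stake N \<omega>"
      by (simp add: eq)
    then have "stake N (sdrop (n + length xs) \<omega>) = stake N \<omega>"
      by (simp add: drop_stake take_stake len min_def sdrop_add)
    then show ?thesis using len by (intro exI[of _ "n + length xs"]) auto
  qed
  then show thesis by (rule that)
qed

lemma bounded_int_attains_bounds:
  fixes f :: "nat \<Rightarrow> int"
  assumes "\<And>n. \<bar>f n\<bar> \<le> c"
  obtains i j where "\<And>n. f n \<le> f i" "\<And>n. f j \<le> f n"
proof -
  have "range f \<subseteq> {-c..c}" using assms by (auto simp: abs_le_iff minus_le_iff)
  then have fin: "finite (range f)" by (rule finite_subset) simp
  have "Max (range f) \<in> range f" "Min (range f) \<in> range f" using fin by auto
  then obtain i j where "Max (range f) = f i" "Min (range f) = f j" by auto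
  with fin that[of i j] show thesis by (metis Max_ge Min_le rangeI)
qed

lemma bounded_gaps_enumeration:
  assumes "\<And>n::nat. \<exists>m\<ge>n. m \<le> n + K \<and> P m" and "P 0"
  obtains t :: "nat \<Rightarrow> nat"
  where "strict_mono t" "t 0 = 0" "\<And>k. P (t k)" "\<And>k. t (Suc k) - t k \<le> Suc K"
proof -
  \<comment> \<open>The clause for \<open>k = 0\<close> pins the first cut to the start of the word.
    Each next cut is sought from \<open>Suc x\<close> on, which makes \<open>t\<close> strictly
    increasing and turns the gap \<open>K\<close> into \<open>Suc K\<close>.\<close>
  have "\<exists>t. \<forall>k. (P (t k) \<and> (k = 0 \<longrightarrow> t k = 0)) \<and> t k < t (Suc k) \<and> t (Suc k) \<le> t k + Suc K"
  proof (rule dependent_nat_choice)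
    show "\<exists>x. P x \<and> (0 = 0 \<longrightarrow> x = 0)" using assms(2) by blast
    show "\<exists>y. (P y \<and> (Suc k = 0 \<longrightarrow> y = 0)) \<and> x < y \<and> y \<le> x + Suc K" for x k
      using assms(1)[of "Suc x"] by auto
  qed
  then obtain t where "\<And>k. P (t k)" "t 0 = 0" "\<And>k. t k < t (Suc k)" "\<And>k. t (Suc k) \<le> t k + Suc K"
    by blast
  with that[of t] show thesis by (simp add: strict_mono_Suc_iff le_diff_conv add.commute)
qed

theorem theorem2p6:
  fixes S :: "int set" and \<omega> :: "int stream"
  assumes "finite S"
    and "\<omega> \<in> streams S"
    and "uniformly_recurrent \<omega>"
    and "bounded_additive_complexity \<omega>"
    and "slope \<omega> \<in> \<rat>"
  shows "\<exists>(A :: int list) (B :: int list stream).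
           \<omega> = A @- flat B \<and>
           (\<forall>i. B !! i \<in> nonempty_factors \<omega>) \<and>
           (\<forall>i. word_slope (B !! i) = slope \<omega>) \<and>
           (\<exists>L. \<forall>i. length (B !! i) \<le> L)"
proof -
  define P where "P n = sum_list (stake n \<omega>)" for n
  obtain C where C: "\<And>n i j. \<bar>sum_list (stake n (sdrop j \<omega>)) - sum_list (stake n (sdrop i \<omega>))\<bar> \<le> C"
    using bounded_additive_complexity_sums assms(1,2,4) by blast
  \<comment> \<open>This compares the window of length \<open>n\<close> at position \<open>m\<close>
    with the one at position 0.\<close>
  have "\<bar>P (m + n) - P m - P n\<bar> \<le> C" for m n
    using C[of n m 0] by (simp add: sum_list_stake_sdrop P_def)
  then have "\<bar>real_of_int (P (m + n)) - P m - P n\<bar> \<le> C" for m n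
    by (metis of_int_abs of_int_diff of_int_le_iff)
  from almost_additive_limit(2)[of "\<lambda>n. real_of_int (P n)", OF this]
  have dev: "\<bar>P n - real n * slope \<omega>\<bar> \<le> C" for n
    by (simp add: slope_def word_slope_def P_def)
  obtain p q :: int where pq: "q > 0" "slope \<omega> = p / q"
    using assms(5) by (metis Rats_cases')
  define f where "f n = q * P n - p * int n" for n
  have "\<bar>f n\<bar> \<le> q * C" for n
  proof -
    have "real_of_int (f n) = q * (P n - real n * slope \<omega>)"
      using pq by (simp add: f_def field_simps)
    then have "\<bar>real_of_int (f n)\<bar> \<le> q * C"
      using dev[of n] pq by (simp add: abs_mult)
    then show ?thesis by (metis of_int_abs of_int_le_iff of_int_mult)
  qed
  then obtain i j where ij: "\<And>n. f n \<le> f i" "\<And>n. f j \<le> f n"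
    using bounded_int_attains_bounds by blast
  \<comment> \<open>The prefix of length \<open>N\<close> reaches both extremal positions, and
    \<open>Suc\<close> ensures \<open>N \<ge> 1\<close>.\<close>
  define N where "N = Suc (max i j)"
  obtain K where K: "\<And>n. \<exists>m\<ge>n. m \<le> n + K \<and> stake N (sdrop m \<omega>) = stake N \<omega>"
    using uniformly_recurrent_prefix[OF assms(3), of N] by (auto simp: N_def)
  have zero: "f m = 0" if m: "stake N (sdrop m \<omega>) = stake N \<omega>" for m
  proof -
    have "f (m + t) = f m + f t" if "t \<le> N" for t
    proof -
      have "stake t (sdrop m \<omega>) = stake t \<omega>"
        using arg_cong[OF m, of "take t"] that by (simp add: take_stake min_def)
      then have "P (m + t) - P m = P t"
        using sum_list_stake_sdrop[of t m \<omega>] by (simp add: P_def)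
      then have "P (m + t) = P m + P t" by simp
      then show ?thesis by (simp add: f_def algebra_simps)
    qed
    \<comment> \<open>\<open>f m + f i \<le> f i\<close> gives \<open>f m \<le> 0\<close>, and
      \<open>f j \<le> f m + f j\<close> gives the reverse inequality.\<close>
    from this[of i] this[of j] ij(1)[of "m + i"] ij(2)[of "m + j"] show ?thesis
      by (simp add: N_def)
  qed
  obtain t where t: "strict_mono t" "t 0 = 0" "\<And>k. f (t k) = 0" "\<And>k. t (Suc k) - t k \<le> Suc K"
  proof (rule bounded_gaps_enumeration[of K "\<lambda>m. f m = 0"])
    show "\<exists>m\<ge>n. m \<le> n + K \<and> f m = 0" for n using K zero by blast
    show "f 0 = 0" by (simp add: f_def P_def)
  qed blast
  define B where "B = smap (\<lambda>i. stake (t (Suc i) - t i) (sdrop (t i) \<omega>)) nats"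
  have B: "B !! k = stake (t (Suc k) - t k) (sdrop (t k) \<omega>)" for k by (simp add: B_def)
  have less: "t k < t (Suc k)" for k using t(1) by (simp add: strict_mono_Suc_iff)
  have "\<omega> = [] @- flat B"
    using sdrop_eq_flat_blocks[OF t(1), of 0 \<omega>] t(2) by (simp add: B_def)
  moreover have "B !! k \<in> nonempty_factors \<omega>" for k
    using less[of k] by (force simp: nonempty_factors_def factors_of_length_def B)
  moreover have "word_slope (B !! k) = slope \<omega>" for k
  proof -
    \<comment> \<open>Since \<open>f\<close> vanishes at both ends of the block, \<open>q\<close>
      times its sum equals \<open>p\<close> times its length.\<close>
    have "q * (P (t (Suc k)) - P (t k)) = p * (int (t (Suc k)) - int (t k))"
      using t(3)[of k] t(3)[of "Suc k"] by (simp add: f_def algebra_simps)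
    then have "real_of_int q * (P (t (Suc k)) - P (t k)) = p * (real (t (Suc k)) - real (t k))"
      by (metis of_int_diff of_int_mult of_int_of_nat_eq)
    then have "(P (t (Suc k)) - P (t k)) / (real (t (Suc k)) - real (t k)) = p / q"
      using pq less[of k] by (simp add: frac_eq_eq mult.commute)
    then show ?thesis
      using pq less[of k] by (simp add: word_slope_def B sum_list_stake_sdrop P_def of_nat_diff)
  qed
  moreover have "length (B !! k) \<le> Suc K" for k using t(4) by (simp add: B)
  ultimately show ?thesis by blast
qed

end
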